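(* Let $G$ be a tree, let $p\ge q>1$ be integers, and let $H$ be a finite collection of subgraphs of $G$, each consisting of at most $d$ connected components. If $H$ satisfies the $(p,q)$ property, then $$\tau^*(H)\le \max\Big\{\frac{2^{\frac{1}{q-1}}(ep)^\frac{q}{q-1}}{q}\, d^{\frac{1}{q-1}} + 1,~ 2p^2\Big\}.$$
   Context: $H$ satisfies the $(p,q)$ property if among any $p$ elements of $H$ some $q$ share a common vertex of $G$. $\tau^*(H)$ is the fractional covering number: the minimum of $\sum_{v}g(v)$ over functions $g:V(G)\to\mathbb{R}_{\ge0}$ with $\sum_{v\in V(h)}g(v)\ge 1$ for every $h\in H$. Here $e$ is Euler's number. *)

theory Defs
  imports "HOL-Analysis.Infinite_Sum" "Graph_Theory.Digraph_Component"
begin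

text \<open>
  An undirected simple graph, finite or infinite, is a loop-free symmetric digraph without parallel
  arcs (\<^locale>\<open>pair_bidirected_digraph\<close>): the edge \<open>uv\<close> is the pair of arcs \<open>(u, v)\<close>, \<open>(v, u)\<close>.
\<close>

text \<open>
  The library's \<^const>\<open>tree\<close> does not apply to symmetric digraphs, because it counts \<open>u, v, u\<close> as a
  directed cycle. A cycle of the undirected graph is a directed cycle of length at least 3.
  Connectedness includes that the vertex set is nonempty.
\<close>

definition undirected_tree :: "'a pair_pre_digraph \<Rightarrow> bool" where
  "undirected_tree G \<longleftrightarrow>
     pair_bidirected_digraph G \<and>
     Digraph_Component.connected (with_proj G) \<and>
     \<not> (\<exists>c. pre_digraph.cycle (with_proj G) c \<and> 3 \<le> length c)"

text \<open>
  Subgraphs need not be induced. As usual for graphs they are nonempty; an empty member of a family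
  could not be covered at all.
\<close>

definition undirected_subgraph :: "'a pair_pre_digraph \<Rightarrow> 'a pair_pre_digraph \<Rightarrow> bool" where
  "undirected_subgraph h G \<longleftrightarrow>
     subgraph (with_proj h) (with_proj G) \<and> pair_bidirected_digraph h \<and> pverts h \<noteq> {}"

text \<open>In a symmetric digraph the strongly connected components are the connected components.\<close>

definition at_most_components :: "nat \<Rightarrow> 'a pair_pre_digraph \<Rightarrow> bool" where
  "at_most_components d h \<longleftrightarrow>
     finite (pre_digraph.sccs (with_proj h)) \<and> card (pre_digraph.sccs (with_proj h)) \<le> d"

definition pq_property ::
    "'a pair_pre_digraph \<Rightarrow> 'a pair_pre_digraph set \<Rightarrow> nat \<Rightarrow> nat \<Rightarrow> bool" where
  "pq_property G H p q \<longleftrightarrow>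
     (\<forall>F \<subseteq> H. finite F \<and> card F = p \<longrightarrow>
       (\<exists>F' \<subseteq> F. card F' = q \<and> (\<exists>v \<in> pverts G. \<forall>h \<in> F'. v \<in> pverts h)))"

text \<open>
  Fractional covers of finite total weight. For finite \<open>G\<close> the summability condition is vacuous and
  the infinite sums are ordinary sums.
\<close>

definition fractional_cover ::
    "'a pair_pre_digraph \<Rightarrow> 'a pair_pre_digraph set \<Rightarrow> ('a \<Rightarrow> real) \<Rightarrow> bool" where
  "fractional_cover G H g \<longleftrightarrow>
     (\<forall>v \<in> pverts G. 0 \<le> g v) \<and> g summable_on pverts G \<and>
     (\<forall>h \<in> H. 1 \<le> (\<Sum>\<^sub>\<infinity>v \<in> pverts h. g v))"

definition fractional_covering_number ::
    "'a pair_pre_digraph \<Rightarrow> 'a pair_pre_digraph set \<Rightarrow> real" where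
  "fractional_covering_number G H =
     Inf {(\<Sum>\<^sub>\<infinity>v \<in> pverts G. g v) | g. fractional_cover G H g}"

end

theory Submission
  imports Defs "HOL-Probability.Product_PMF"
begin

text \<open>
  Let \<open>B\<close> be the claimed bound and suppose \<open>B < \<tau>\<^sup>*(H)\<close>. By linear programming duality there is
  a probability distribution on \<open>H\<close> under which every vertex lies in a random member with
  probability at most \<open>1/B\<close>. Draw \<open>p\<close> independent members. Some two of them coincide with probability
  at most \<open>(p choose 2)/B \<le> 1/4\<close>; otherwise some \<open>q\<close> of them have a common vertex. On the other hand,
  root the tree and let the root of a component be its highest vertex. If members of \<open>H\<close> share a
  vertex, then they share a root of a component of one of them. Each member has at most \<open>d\<close> such
  roots, so \<open>q\<close> random members share a vertex with probability at most \<open>q d B\<^sup>1\<^sup>-\<^sup>q\<close>. Hence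
  \<open>3/4 \<le> (p choose q) q d B\<^sup>1\<^sup>-\<^sup>q\<close>, which contradicts the choice of \<open>B\<close>.
\<close>

section \<open>Duality\<close>

text \<open>
  Only weak inequalities are claimed for the separating functional, so \<open>K\<close> needs neither closedness
  nor finite generation, and induction on \<open>I\<close> suffices: the weight of a new coordinate \<open>a\<close> is the
  largest one compatible with the points of \<open>K\<close> that are positive at \<open>a\<close>.
\<close>

lemma convex_positive_or_separated:
  fixes K :: "('i \<Rightarrow> real) set"
  assumes "finite I" and "K \<noteq> {}"
    and "\<And>x y t. x \<in> K \<Longrightarrow> y \<in> K \<Longrightarrow> 0 \<le> t \<Longrightarrow> t \<le> 1 \<Longrightarrow> (\<lambda>i. t * x i + (1 - t) * y i) \<in> K"
    and "\<not> (\<exists>x\<in>K. \<forall>i\<in>I. 0 < x i)"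
  shows "\<exists>w. (\<forall>i\<in>I. 0 \<le> w i) \<and> (\<exists>i\<in>I. 0 < w i) \<and> (\<forall>x\<in>K. (\<Sum>i\<in>I. w i * x i) \<le> 0)"
  using assms
proof (induction I arbitrary: K rule: finite_induct)
  case empty
  then show ?case by auto
next
  case (insert a I)
  note conv = insert.prems(2)
  define L where "L = {x \<in> K. 0 < x a}"
  show ?case
  proof (cases "L = {}")
    case True
    \<comment> \<open>No point of \<open>K\<close> is positive at \<open>a\<close>, so the
      coordinate functional at \<open>a\<close> already separates.\<close>
    have "(\<Sum>i\<in>insert a I. (if i = a then 1 else 0) * x i) = x a" for x :: "'i \<Rightarrow> real"
      using insert.hyps by (subst sum.insert) (auto intro!: sum.neutral)
    then show ?thesis
      using True unfolding L_def by (intro exI[of _ "\<lambda>i. if i = a then 1 else 0"]) auto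
  next
    case False
    have convL: "(\<lambda>i. t * x i + (1 - t) * y i) \<in> L"
      if "x \<in> L" "y \<in> L" "0 \<le> t" "t \<le> 1" for x y t
    proof -
      have "0 < t * x a + (1 - t) * y a"
        using that convex_bound_lt[of "- x a" 0 "- y a" t "1 - t"] unfolding L_def by auto
      then show ?thesis using that conv unfolding L_def by auto
    qed
    \<comment> \<open>A point of \<open>L\<close> positive on \<open>I\<close> would be positive on
      all of \<open>insert a I\<close>, so the induction hypothesis applies to
      \<open>L\<close>.\<close>
    have "\<not> (\<exists>x\<in>L. \<forall>i\<in>I. 0 < x i)"
      using insert.prems(3) unfolding L_def by blast
    then obtain w where w: "\<forall>i\<in>I. 0 \<le> w i" "\<exists>i\<in>I. 0 < w i"
      and wL: "\<forall>x\<in>L. (\<Sum>i\<in>I. w i * x i) \<le> 0"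
      using insert.IH[OF False convL] by blast
    define W where "W x = (\<Sum>i\<in>I. w i * x i)" for x
    have W_conv: "W (\<lambda>i. t * x i + (1 - t) * y i) = t * W x + (1 - t) * W y" for t x y
      unfolding W_def by (simp add: sum.distrib sum_subtractf sum_distrib_left algebra_simps)
    have W_pos: "W x \<le> 0" if "x \<in> K" "0 < x a" for x
      using wL that unfolding L_def W_def by auto
    obtain y0 where y0: "y0 \<in> K" "0 < y0 a" using False unfolding L_def by auto
    have W_nonneg: "W x \<le> 0" if x: "x \<in> K" "0 \<le> x a" for x
    proof (rule ccontr)
      assume "\<not> W x \<le> 0"
      then have Wx: "0 < W x" by simp
      \<comment> \<open>Half of the parameter at which \<open>W\<close> would vanish on the segment
        from \<open>x\<close> to \<open>y0\<close>: the mixture is positive at \<open>a\<close>, yet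
        its \<open>W\<close> is \<open>W x / 2\<close>.\<close>
      define t where "t = W x / (2 * (W x - W y0))"
      have "W y0 \<le> 0" using W_pos y0 by simp
      have t: "0 < t" "t < 1" "t * (W x - W y0) < W x"
        unfolding t_def using Wx \<open>W y0 \<le> 0\<close> by (auto simp: field_simps)
      have "0 < t * y0 a + (1 - t) * x a"
        using t y0 x by (intro add_pos_nonneg) auto
      then have "t * W y0 + (1 - t) * W x \<le> 0"
        using W_pos[of "\<lambda>i. t * y0 i + (1 - t) * x i"] conv[OF y0(1) x(1), of t] t W_conv by simp
      then show False using t by (simp add: algebra_simps)
    qed
    \<comment> \<open>A point negative at \<open>a\<close> bounds the new weight below by
      \<open>W x / (- x a)\<close>, and a point positive at \<open>a\<close> bounds it above by
      \<open>- W y / y a\<close>. Applying \<open>W_nonneg\<close> to the mixture that vanishes at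
      \<open>a\<close> shows that no lower bound exceeds an upper bound.\<close>
    have cross: "W x * y a - W y * x a \<le> 0"
      if x: "x \<in> K" "x a < 0" and y: "y \<in> K" "0 < y a" for x y
    proof -
      define t where "t = y a / (y a - x a)"
      have t: "0 \<le> t" "t \<le> 1" "t * x a + (1 - t) * y a = 0"
        unfolding t_def using x y by (auto simp: field_simps)
      have "t * W x + (1 - t) * W y \<le> 0"
        using W_nonneg[of "\<lambda>i. t * x i + (1 - t) * y i"] conv[OF x(1) y(1), of t] t W_conv by simp
      then have "(y a - x a) * (t * W x + (1 - t) * W y) \<le> 0"
        using x y by (intro mult_nonneg_nonpos) auto
      also have "(y a - x a) * (t * W x + (1 - t) * W y) = W x * y a - W y * x a"
      proof -
        have t': "(y a - x a) * t = y a" "(y a - x a) * (1 - t) = - x a"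
          unfolding t_def using x y by (simp_all add: right_diff_distrib)
        have "(y a - x a) * (t * W x + (1 - t) * W y)
            = ((y a - x a) * t) * W x + ((y a - x a) * (1 - t)) * W y"
          by (simp add: algebra_simps)
        then show ?thesis unfolding t' by simp
      qed
      finally show ?thesis .
    qed
    define s where "s = (INF y\<in>L. - W y / y a)"
    have ge0: "0 \<le> - W y / y a" if "y \<in> L" for y
      using that W_pos[of y] unfolding L_def by (auto simp: field_simps)
    have s_nonneg: "0 \<le> s"
      unfolding s_def using False ge0 by (intro cINF_greatest) auto
    have bdd: "bdd_below ((\<lambda>y. - W y / y a) ` L)"
      using ge0 by (auto intro!: bdd_belowI[of _ 0])
    have total: "s * x a + W x \<le> 0" if x: "x \<in> K" for x
    proof (cases "x a" "0 :: real" rule: linorder_cases)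
      case less
      have "W x / (- x a) \<le> s"
        unfolding s_def
      proof (rule cINF_greatest[OF False])
        fix y assume "y \<in> L"
        then have y: "y \<in> K" "0 < y a" by (auto simp: L_def)
        show "W x / - x a \<le> - W y / y a"
          using cross[OF x less y] less y by (simp add: field_simps)
      qed
      then show ?thesis using less by (simp add: field_simps)
    next
      case equal
      then show ?thesis using W_nonneg[OF x] by simp
    next
      case greater
      then have "s \<le> - W x / x a"
        unfolding s_def using x by (intro cINF_lower[OF bdd]) (simp add: L_def)
      then show ?thesis using greater by (simp add: field_simps)
    qed
    have "(\<Sum>i\<in>insert a I. (w(a := s)) i * x i) = s * x a + W x" for x
      using insert.hyps unfolding W_def by (auto intro!: sum.cong)
    then show ?thesis
      using w s_nonneg total insert.hyps by (intro exI[of _ "w(a := s)"]) auto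
  qed
qed

text \<open>Consider the excess vectors of all nonnegative weightings of total exactly
  \<open>B\<close>. None is positive on all of \<open>H\<close>, since such a weighting would be a
  cover of total below the infimum. A separating functional therefore exists. Evaluating it at the
  weighting that puts all of \<open>B\<close> on \<open>v\<close> bounds the load at
  \<open>v\<close>, and dividing by the total \<open>W\<close> turns it into a probability
  distribution.\<close>

lemma fractional_covering_number_duality:
  assumes nonempty: "pverts G \<noteq> {}" and fin: "finite H"
    and sub: "\<And>h. h \<in> H \<Longrightarrow> pverts h \<subseteq> pverts G"
    and B: "0 \<le> B" "B < fractional_covering_number G H"
  obtains w where "\<And>h. h \<in> H \<Longrightarrow> 0 \<le> w h" and "(\<Sum>h\<in>H. w h) = 1"
    and "\<And>v. v \<in> pverts G \<Longrightarrow> B * (\<Sum>h\<in>{h\<in>H. v \<in> pverts h}. w h) \<le> 1"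
proof -
  define A where "A = {g. (\<forall>v\<in>pverts G. 0 \<le> g v) \<and> g summable_on pverts G \<and>
    (\<Sum>\<^sub>\<infinity>v\<in>pverts G. g v) = B}"
  \<comment> \<open>Coordinates outside \<open>H\<close> are left free, so membership in
    \<open>K\<close> is a condition on \<open>H\<close> alone.\<close>
  define K :: "('a pair_pre_digraph \<Rightarrow> real) set"
    where "K = {x. \<exists>g\<in>A. \<forall>h\<in>H. x h = (\<Sum>\<^sub>\<infinity>v\<in>pverts h. g v) - 1}"
  have KI: "(\<lambda>h. (\<Sum>\<^sub>\<infinity>v\<in>pverts h. g v) - 1) \<in> K" if "g \<in> A" for g
    unfolding K_def using that by blast
  have point: "(\<lambda>u. if u = v then B else 0) \<in> A" if "v \<in> pverts G" for v
  proof -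
    have "((\<lambda>u. if u = v then B else 0) has_sum B) (pverts G)"
      using that has_sum_finite_neutralI[of "{v}" "pverts G" "\<lambda>u. if u = v then B else 0" B] by auto
    then show ?thesis
      unfolding A_def using B by (auto simp: infsumI has_sum_imp_summable)
  qed
  have summ: "g summable_on pverts h" if "g \<in> A" "h \<in> H" for g h
    using that sub summable_on_subset_banach unfolding A_def by blast
  have conv: "(\<lambda>h. t * x h + (1 - t) * y h) \<in> K"
    if xy: "x \<in> K" "y \<in> K" and t: "0 \<le> t" "t \<le> 1" for x y t
  proof -
    obtain g g' where g: "g \<in> A" "g' \<in> A"
      and x: "\<forall>h\<in>H. x h = (\<Sum>\<^sub>\<infinity>v\<in>pverts h. g v) - 1"
      and y: "\<forall>h\<in>H. y h = (\<Sum>\<^sub>\<infinity>v\<in>pverts h. g' v) - 1"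
      using xy unfolding K_def by blast
    define k where "k v = t * g v + (1 - t) * g' v" for v
    have lin: "(k has_sum t * infsum g S + (1 - t) * infsum g' S) S"
      if "g summable_on S" "g' summable_on S" for S
      unfolding k_def using that by (intro has_sum_add has_sum_cmult_right) auto
    have "k \<in> A"
    proof -
      have "(k has_sum B) (pverts G)"
        using lin[of "pverts G"] g unfolding A_def by (simp add: algebra_simps)
      moreover have "0 \<le> k v" if "v \<in> pverts G" for v
        using that g t unfolding k_def A_def by simp
      ultimately show ?thesis
        unfolding A_def by (auto simp: infsumI has_sum_imp_summable)
    qed
    moreover have "t * x h + (1 - t) * y h = infsum k (pverts h) - 1" if "h \<in> H" for h
    proof -
      have "infsum g (pverts h) = x h + 1" "infsum g' (pverts h) = y h + 1"
        using x y that by auto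
      then have "infsum k (pverts h) = t * (x h + 1) + (1 - t) * (y h + 1)"
        using infsumI[OF lin[OF summ[OF g(1) that] summ[OF g(2) that]]] by simp
      then show ?thesis by (simp add: algebra_simps)
    qed
    ultimately show ?thesis unfolding K_def by blast
  qed
  have "\<not> (\<exists>x\<in>K. \<forall>h\<in>H. 0 < x h)"
  proof
    assume "\<exists>x\<in>K. \<forall>h\<in>H. 0 < x h"
    then obtain g where g: "g \<in> A" "\<forall>h\<in>H. 1 < (\<Sum>\<^sub>\<infinity>v\<in>pverts h. g v)"
      unfolding K_def by auto
    then have "fractional_cover G H g" and total: "B = (\<Sum>\<^sub>\<infinity>v\<in>pverts G. g v)"
      unfolding fractional_cover_def A_def by (auto intro: less_imp_le)
    then have "fractional_covering_number G H \<le> B"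
      unfolding fractional_covering_number_def
      by (intro cInf_lower bdd_belowI[of _ 0])
         (auto simp: fractional_cover_def intro!: infsum_nonneg)
    then show False using B(2) by simp
  qed
  then obtain w where w: "\<forall>h\<in>H. 0 \<le> w h" "\<exists>h\<in>H. 0 < w h"
    and wK: "\<forall>x\<in>K. (\<Sum>h\<in>H. w h * x h) \<le> 0"
    using convex_positive_or_separated[OF fin _ conv] KI point nonempty by blast
  define W where "W = (\<Sum>h\<in>H. w h)"
  have "0 < W"
    unfolding W_def using w fin by (metis sum_pos2)
  have load: "B * (\<Sum>h\<in>{h\<in>H. v \<in> pverts h}. w h) \<le> W" if v: "v \<in> pverts G" for v
  proof -
    have "(\<Sum>\<^sub>\<infinity>u\<in>pverts h. if u = v then B else 0) = (if v \<in> pverts h then B else 0)"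
      for h :: "'a pair_pre_digraph"
      by (auto intro!: infsumI has_sum_finite_neutralI[of "if v \<in> pverts h then {v} else {}"])
    then have "(\<Sum>h\<in>H. w h * ((if v \<in> pverts h then B else 0) - 1)) \<le> 0"
      using bspec[OF wK KI[OF point[OF v]]] by simp
    also have "(\<Sum>h\<in>H. w h * ((if v \<in> pverts h then B else 0) - 1))
        = (\<Sum>h\<in>H. B * (if v \<in> pverts h then w h else 0) - w h)"
      by (intro sum.cong) (auto simp: algebra_simps)
    also have "\<dots> = B * (\<Sum>h\<in>{h\<in>H. v \<in> pverts h}. w h) - W"
      using fin by (simp add: W_def sum_subtractf sum_distrib_left sum.inter_filter)
    finally show ?thesis by simp
  qed
  show ?thesis
  proof (rule that[of "\<lambda>h. w h / W"])
    show "(\<Sum>h\<in>H. w h / W) = 1"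
      using \<open>0 < W\<close> by (simp add: W_def flip: sum_divide_distrib)
    fix v assume "v \<in> pverts G"
    then show "B * (\<Sum>h\<in>{h\<in>H. v \<in> pverts h}. w h / W) \<le> 1"
      using load[of v] \<open>0 < W\<close> by (simp add: field_simps flip: sum_divide_distrib)
  qed (use w \<open>0 < W\<close> in auto)
qed

section \<open>Roots of subtrees\<close>

text \<open>A path avoiding \<open>x\<close> between two distinct neighbours of \<open>x\<close> has
  at least one arc. Closing it up through \<open>x\<close> adds two more, which gives a cycle of
  length at least 3.\<close>

lemma undirected_tree_no_detour:
  assumes tree: "undirected_tree G"
    and arcs: "(x, y) \<in> parcs G" "(x, y') \<in> parcs G"
    and detour: "(y, y') \<in> (parcs G \<inter> (- {x}) \<times> (- {x}))\<^sup>*"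
  shows "y = y'"
proof (rule ccontr)
  assume neq: "y \<noteq> y'"
  interpret pair_bidirected_digraph G
    using tree by (simp add: undirected_tree_def)
  have yx: "y \<noteq> x" using arcs no_loops by fastforce
  \<comment> \<open>The graph \<open>G\<close> with \<open>x\<close> deleted: a simple path found
    here is a path of \<open>G\<close> that misses \<open>x\<close>.\<close>
  define K where "K = \<lparr>pverts = pverts G - {x}, parcs = parcs G \<inter> (- {x}) \<times> (- {x})\<rparr>"
  have K_simps: "pverts K = pverts G - {x}" "parcs K = parcs G \<inter> (- {x}) \<times> (- {x})"
    by (simp_all add: K_def)
  interpret K: pair_wf_digraph K
    by unfold_locales (auto simp: K_simps dest: in_arcsD1 in_arcsD2)
  have "y \<rightarrow>\<^sup>*\<^bsub>K\<^esub> y'"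
    using detour
  proof (induction rule: rtrancl_induct)
    case base
    then show ?case using arcs(1) yx in_arcsD2 by (auto simp: K_simps)
  next
    case (step z w)
    then show ?case by (intro K.reachable_adj_trans[of y z w]) (simp_all add: K_simps)
  qed
  then obtain p where p: "K.apath y p y'"
    using K.reachable_apath by blast
  then have pG: "apath y p y'"
    by (auto simp: apath_def awalk_def K.apath_def K.awalk_def K_simps)
  have "set (pawalk_verts y p) \<subseteq> pverts K"
    using K.awalkI_apath[OF p] by auto
  then have xp: "x \<notin> set (pawalk_verts y p)" by (auto simp: K_simps)
  have "p \<noteq> []" using pG neq by (auto simp: apath_def awalk_Nil_iff)
  define c where "c = (x, y) # p @ [(y', x)]"
  have "(y', x) \<in> parcs G" using arcs(2) arcs_symmetric by blast
  then have walk: "awalk x c x"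
    using pG arcs unfolding c_def by (auto simp: apath_def awalk_simps dest: in_arcsD1)
  moreover have "pawalk_verts u (p @ [(y', x)]) = pawalk_verts u p @ [x]" if "pcas u p y'" for u
    using that by (induction p arbitrary: u) auto
  then have "tl (pawalk_verts x c) = pawalk_verts y p @ [x]"
    using pG by (simp add: c_def apath_def awalk_def)
  moreover have "distinct (pawalk_verts y p @ [x])"
    using pG xp by (simp add: apath_def)
  moreover have "3 \<le> length c" using \<open>p \<noteq> []\<close> unfolding c_def by (cases p) auto
  ultimately have "cycle c \<and> 3 \<le> length c"
    unfolding cycle_def by (auto simp: c_def)
  then show False using tree by (auto simp: undirected_tree_def)
qed

text \<open>Root the tree at some \<open>r\<close> and let \<open>dep\<close> be the distance from
  \<open>r\<close>. Two neighbours of \<open>x\<close> that are no deeper than \<open>x\<close> are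
  both linked to \<open>r\<close> without passing through \<open>x\<close>, so they coincide by
  \<open>undirected_tree_no_detour\<close>. This single neighbour is the parent.\<close>

lemma undirected_tree_parent_function:
  assumes tree: "undirected_tree G"
  obtains par :: "'a \<Rightarrow> 'a" and dep :: "'a \<Rightarrow> nat"
  where "\<And>x y. (x, y) \<in> parcs G \<Longrightarrow>
    (y = par x \<and> dep y < dep x) \<or> (x = par y \<and> dep x < dep y)"
proof -
  interpret pair_bidirected_digraph G
    using tree by (simp add: undirected_tree_def)
  let ?E = "parcs G"
  have "strongly_connected (mk_symmetric (with_proj G))"
    using tree by (simp add: undirected_tree_def connected_def)
  then obtain r where r: "r \<in> pverts G" and "\<And>z. z \<in> pverts G \<Longrightarrow> r \<rightarrow>\<^sup>*\<^bsub>mk_symmetric (with_proj G)\<^esub> z"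
    unfolding strongly_connected_def by auto
  then have reach: "(r, z) \<in> ?E\<^sup>*" if "z \<in> pverts G" for z
    using that reachable_mk_symmetric_eq[OF pair_sym_arcs] reachable_rtranclI[of "with_proj G" r z] by simp
  define dep where "dep z = (LEAST n. (r, z) \<in> ?E ^^ n)" for z
  have dep: "(r, z) \<in> ?E ^^ dep z" if "z \<in> pverts G" for z
    unfolding dep_def using reach[OF that] by (metis LeastI rtrancl_imp_relpow)
  have dep_le: "dep z \<le> n" if "(r, z) \<in> ?E ^^ n" for z n
    unfolding dep_def using that by (rule Least_le)
  have up: "\<exists>y. (y, z) \<in> ?E \<and> dep y < dep z" if z: "z \<in> pverts G" "z \<noteq> r" for z
  proof (cases "dep z")
    case 0
    then show ?thesis using dep[OF z(1)] z(2) by simp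
  next
    case (Suc n)
    then obtain y where "(r, y) \<in> ?E ^^ n" "(y, z) \<in> ?E"
      using dep[OF z(1)] Suc by auto
    then show ?thesis using dep_le[of y n] Suc by (intro exI[of _ y]) simp
  qed
  have sym: "sym (?E \<inter> (- {x}) \<times> (- {x}))" for x
    using arcs_symmetric unfolding sym_def by blast
  \<comment> \<open>Going from \<open>z\<close> to ever shallower neighbours ends in
    \<open>r\<close>. All vertices after \<open>z\<close> are strictly shallower than
    \<open>x\<close>, so \<open>x\<close> is never met.\<close>
  have shallow: "(r, z) \<in> (?E \<inter> (- {x}) \<times> (- {x}))\<^sup>*"
    if "x \<noteq> r" "z \<in> pverts G" "z \<noteq> x" "dep z \<le> dep x" for x z
    using that(2-)
  proof (induction "dep z" arbitrary: z rule: less_induct)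
    case less
    show ?case
    proof (cases "z = r")
      case False
      then obtain y where y: "(y, z) \<in> ?E" "dep y < dep z" using up[OF less.prems(1)] by blast
      then have "(r, y) \<in> (?E \<inter> (- {x}) \<times> (- {x}))\<^sup>*"
        using less.prems in_arcsD1[OF y(1)] by (intro less.hyps) (simp, simp, force, simp)
      moreover have "(y, z) \<in> ?E \<inter> (- {x}) \<times> (- {x})"
        using y less.prems by force
      ultimately show ?thesis by (rule rtrancl_into_rtrancl)
    qed simp
  qed
  have "dep r = 0" using dep_le[of r 0] by simp
  have not_root: "x \<noteq> r" if "(x, y) \<in> ?E" "dep y \<le> dep x" for x y
  proof
    assume "x = r"
    then have "(r, y) \<in> ?E ^^ 0"
      using that dep[OF in_arcsD2[OF that(1)]] \<open>dep r = 0\<close> by simp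
    then show False using \<open>x = r\<close> no_loops'[OF that(1)] by simp
  qed
  have unique: "y = y'"
    if "(x, y) \<in> ?E" "(x, y') \<in> ?E" "dep y \<le> dep x" "dep y' \<le> dep x" for x y y'
  proof -
    have "(r, z) \<in> (?E \<inter> (- {x}) \<times> (- {x}))\<^sup>*" if "(x, z) \<in> ?E" "dep z \<le> dep x" for z
      by (rule shallow[OF not_root[OF that] in_arcsD2[OF that(1)] no_loops'[OF that(1), THEN not_sym] that(2)])
    then have "(r, y) \<in> (?E \<inter> (- {x}) \<times> (- {x}))\<^sup>*" "(r, y') \<in> (?E \<inter> (- {x}) \<times> (- {x}))\<^sup>*"
      using that by simp_all
    then have "(y, y') \<in> (?E \<inter> (- {x}) \<times> (- {x}))\<^sup>*"
      by (rule rtrancl_trans[OF symD[OF sym_rtrancl[OF sym]]])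
    then show ?thesis using undirected_tree_no_detour[OF tree that(1,2)] by simp
  qed
  \<comment> \<open>The weak inequality rules out arcs between equal depths: any neighbour no deeper
    than \<open>x\<close> must equal the strictly shallower one supplied by \<open>up\<close>. At
    \<open>r\<close> no neighbour qualifies, and the value of \<open>par\<close> is
    arbitrary.\<close>
  define par where "par x = (THE y. (x, y) \<in> ?E \<and> dep y \<le> dep x)" for x
  have par: "y = par x \<and> dep y < dep x" if xy: "(x, y) \<in> ?E" "dep y \<le> dep x" for x y
  proof -
    obtain y' where "(y', x) \<in> ?E" "dep y' < dep x"
      using up[OF in_arcsD1[OF xy(1)] not_root[OF xy]] by blast
    then have "y = y'" using unique[OF xy(1) arcs_symmetric xy(2)] by simp
    moreover have "par x = y"
      unfolding par_def using xy by (blast intro: the_equality unique)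
    ultimately show ?thesis using \<open>dep y' < dep x\<close> by simp
  qed
  show ?thesis
  proof (rule that)
    fix x y assume "(x, y) \<in> ?E"
    then show "(y = par x \<and> dep y < dep x) \<or> (x = par y \<and> dep x < dep y)"
      using par[of x y] par[of y x] arcs_symmetric[of x y] nat_le_linear[of "dep x" "dep y"] by blast
  qed
qed

text \<open>
  The root of a component is its vertex closest to the root of the tree; climbing from any vertex of
  the component to its root stays inside the component. Hence all roots of components through \<open>v\<close>
  are ancestors of \<open>v\<close>, and the one nearest to \<open>v\<close> lies in all these components.
\<close>

lemma subtree_roots:
  assumes tree: "undirected_tree G"
    and sub: "\<And>h. h \<in> H \<Longrightarrow> undirected_subgraph h G"
    and comp: "\<And>h. h \<in> H \<Longrightarrow> at_most_components d h"
  obtains R where "\<And>h. h \<in> H \<Longrightarrow> finite (R h) \<and> card (R h) \<le> d \<and> R h \<subseteq> pverts h"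
    and "\<And>F v. F \<subseteq> H \<Longrightarrow> F \<noteq> {} \<Longrightarrow> \<forall>h\<in>F. v \<in> pverts h \<Longrightarrow>
      \<exists>h\<in>F. \<exists>x\<in>R h. \<forall>h'\<in>F. x \<in> pverts h'"
proof -
  obtain par :: "'a \<Rightarrow> 'a" and dep :: "'a \<Rightarrow> nat" where dep_par: "\<And>x y. (x, y) \<in> parcs G \<Longrightarrow>
    (y = par x \<and> dep y < dep x) \<or> (x = par y \<and> dep x < dep y)"
    by (rule undirected_tree_parent_function[OF tree]) blast
  define \<rho> where "\<rho> C = (SOME x. x \<in> C \<and> (\<forall>y\<in>C. dep x \<le> dep y))" for C
  have \<rho>: "\<rho> C \<in> C \<and> (\<forall>y\<in>C. dep (\<rho> C) \<le> dep y)" if C: "C \<noteq> {}" for C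
      proof -
    obtain k where "k \<in> C" using C by blast
    then have "\<exists>x. x \<in> C \<and> (\<forall>y\<in>C. dep x \<le> dep y)"
      using ex_has_least_nat[of "\<lambda>x. x \<in> C" k dep] by blast
    then show ?thesis unfolding \<rho>_def by (rule someI_ex)
  qed
  define R where "R h = \<rho> ` pre_digraph.sccs_verts (with_proj h)" for h
  have R: "finite (R h) \<and> card (R h) \<le> d \<and> R h \<subseteq> pverts h" if "h \<in> H" for h
  proof -
    interpret h: pair_bidirected_digraph h
      using sub[OF that] by (simp add: undirected_subgraph_def)
    have "finite h.sccs_verts" "card h.sccs_verts \<le> d"
      using comp[OF that] h.card_sccs_verts h.sccs_verts_conv by (auto simp: at_most_components_def)
    moreover have "\<rho> S \<in> pverts h" if "S \<in> h.sccs_verts" for S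
      using that \<rho>[of S] h.sccs_verts_subsets[of S] by (auto simp: h.in_sccs_verts_conv_reachable)
    ultimately show ?thesis
      unfolding R_def using card_image_le[of h.sccs_verts \<rho>] by (auto dest: order_trans)
  qed
  have climb: "\<exists>k. (par ^^ k) v \<in> R h \<and> (\<forall>j\<le>k. (par ^^ j) v \<in> pverts h)"
    if "h \<in> H" and v: "v \<in> pverts h" for h v
  proof -
    interpret h: pair_bidirected_digraph h
      using sub[OF \<open>h \<in> H\<close>] by (simp add: undirected_subgraph_def)
    have arcs: "parcs h \<subseteq> parcs G"
      using sub[OF \<open>h \<in> H\<close>] by (auto simp: undirected_subgraph_def subgraph_def)
    define C where "C = h.scc_of v"
    have "v \<in> C" unfolding C_def by (rule h.in_scc_of_self[OF v])
    then have root: "\<rho> C \<in> C" "\<And>y. y \<in> C \<Longrightarrow> dep (\<rho> C) \<le> dep y" using \<rho>[of C] by auto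
    have "\<rho> C \<in> R h"
      unfolding R_def C_def using h.scc_of_in_sccs_verts[OF v] by blast
    have reach_sym: "y \<rightarrow>\<^sup>*\<^bsub>h\<^esub> x" if "x \<rightarrow>\<^sup>*\<^bsub>h\<^esub> y" for x y
      using symmetric_reachable[OF h.sym_arcs that] .
    have C: "u \<in> C \<longleftrightarrow> \<rho> C \<rightarrow>\<^sup>*\<^bsub>h\<^esub> u" for u
      using root(1) unfolding C_def h.scc_of_def mem_Collect_eq
      by (metis reach_sym h.reachable_trans)
    have "\<rho> C \<rightarrow>\<^sup>*\<^bsub>h\<^esub> v" using C \<open>v \<in> C\<close> by blast
    \<comment> \<open>Induction along a walk from the root of the component to \<open>v\<close>: a
      move to the parent drops the first step of the climb, a move to a child prepends one.\<close>
    then have "\<exists>k. (par ^^ k) v = \<rho> C \<and> (\<forall>j\<le>k. (par ^^ j) v \<in> pverts h)"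
    proof (induction rule: h.reachable_induct)
      case base
      then show ?case by (intro exI[of _ 0]) auto
    next
      case (step u u')
      then obtain k where k: "(par ^^ k) u = \<rho> C" "\<forall>j\<le>k. (par ^^ j) u \<in> pverts h" by blast
      have arc: "(u, u') \<in> parcs h" using step.hyps by simp
      have "u' \<in> pverts h" using arc h.in_arcsD2 by blast
      have "u' \<in> C" using C step.hyps h.reachable_adj_trans[of _ u u'] by simp
      from arc arcs dep_par[of u u'] consider "u' = par u" "dep u' < dep u" | "u = par u'" by blast
      then show ?case
      proof cases
        case 1
        \<comment> \<open>If \<open>k\<close> were 0, then \<open>u\<close> would be the root and
          \<open>u'\<close> a shallower vertex of the same component.\<close>
        then obtain k' where "k = Suc k'"
          using k root(2)[OF \<open>u' \<in> C\<close>] by (cases k) auto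
        have climb_u: "(par ^^ j) u' = (par ^^ Suc j) u" for j
          by (simp add: 1(1) funpow_Suc_right del: funpow.simps)
        show ?thesis
          using k \<open>k = Suc k'\<close> by (intro exI[of _ k']) (simp add: climb_u del: funpow.simps)
      next
        case 2
        have climb_u': "(par ^^ Suc j) u' = (par ^^ j) u" for j
          by (simp add: 2 funpow_Suc_right del: funpow.simps)
        have "(par ^^ j) u' \<in> pverts h" if "j \<le> Suc k" for j
          using that k(2) \<open>u' \<in> pverts h\<close> climb_u' by (cases j) (simp_all del: funpow.simps(2))
        then show ?thesis
          using k(1) by (intro exI[of _ "Suc k"]) (simp add: climb_u' del: funpow.simps)
      qed
    qed
    then show ?thesis using \<open>\<rho> C \<in> R h\<close> by metis
  qed
  have "\<exists>h\<in>F. \<exists>x\<in>R h. \<forall>h'\<in>F. x \<in> pverts h'"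
    if F: "F \<subseteq> H" "F \<noteq> {}" and v: "\<forall>h\<in>F. v \<in> pverts h" for F v
  proof -
    have "\<forall>h\<in>F. \<exists>k. (par ^^ k) v \<in> R h \<and> (\<forall>j\<le>k. (par ^^ j) v \<in> pverts h)"
      using climb[of _ v] F v by (meson subsetD)
    then obtain k where k: "\<forall>h\<in>F. (par ^^ k h) v \<in> R h \<and> (\<forall>j\<le>k h. (par ^^ j) v \<in> pverts h)"
      by (auto dest!: bchoice)
    obtain h where "h \<in> F" "\<forall>h'\<in>F. k h \<le> k h'"
      using F(2) ex_has_least_nat[of "\<lambda>h. h \<in> F" _ k] by blast
    then show ?thesis using k by blast
  qed
  then show ?thesis using that[of R] R by blast
qed

section \<open>Sampling\<close>

lemma measure_pmf_UN_le:
  assumes "finite I" and "\<And>i. i \<in> I \<Longrightarrow> measure_pmf.prob M (A i) \<le> b i"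
  shows "measure_pmf.prob M (\<Union>i\<in>I. A i) \<le> sum b I"
proof -
  have "measure_pmf.prob M (\<Union>i\<in>I. A i) \<le> (\<Sum>i\<in>I. measure_pmf.prob M (A i))"
    using assms(1) by (intro measure_pmf.finite_measure_subadditive_finite) auto
  also have "\<dots> \<le> sum b I" using assms(2) by (rule sum_mono)
  finally show ?thesis .
qed

text \<open>A union bound over \<open>p\<close> independent draws from \<open>P\<close>. Each
  outcome either repeats a member or contains, by \<open>pq\<close> and \<open>roots\<close>,
  \<open>q\<close> distinct members sharing a root of one of them. The two sums of probabilities
  must therefore reach 1.\<close>

lemma pq_sampling:
  fixes P :: "'h pmf" and S :: "'h \<Rightarrow> 'v set" and \<epsilon> :: real
  assumes fin: "finite (set_pmf P)"
    and load: "\<And>v. v \<in> V \<Longrightarrow> measure_pmf.prob P {h. v \<in> S h} \<le> \<epsilon>"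
    and meets: "\<And>h. h \<in> set_pmf P \<Longrightarrow> S h \<inter> V \<noteq> {}"
    and R: "\<And>h. h \<in> set_pmf P \<Longrightarrow> finite (R h) \<and> card (R h) \<le> d \<and> R h \<subseteq> V"
    and roots: "\<And>F v. F \<subseteq> set_pmf P \<Longrightarrow> F \<noteq> {} \<Longrightarrow> \<forall>h\<in>F. v \<in> S h \<Longrightarrow>
      \<exists>h\<in>F. \<exists>x\<in>R h. \<forall>h'\<in>F. x \<in> S h'"
    and pq: "\<And>F. F \<subseteq> set_pmf P \<Longrightarrow> card F = p \<Longrightarrow>
      \<exists>F'\<subseteq>F. card F' = q \<and> (\<exists>v. \<forall>h\<in>F'. v \<in> S h)"
    and q: "0 < q"
  shows "1 - real (p choose 2) * \<epsilon> \<le> real (p choose q) * (real q * (real d * \<epsilon> ^ (q - 1)))"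
proof -
  define M where "M = Pi_pmf {..<p} undefined (\<lambda>_. P)"
  define sub where "sub k = {J. J \<subseteq> {..<p} \<and> card J = k}" for k
  have sub: "finite (sub k)" "card (sub k) = p choose k" for k
    unfolding sub_def using n_subsets[of "{..<p}" k] by auto
  \<comment> \<open>In \<open>col K h\<close> all draws with index in \<open>K\<close> equal
    \<open>h\<close>. In \<open>inc J i h x\<close> draw \<open>i\<close> is \<open>h\<close> and
    the other draws with index in \<open>J\<close> contain \<open>x\<close>. Fixing \<open>h\<close>
    first makes the root \<open>x\<close> deterministic, so both events are products and
    independence applies.\<close>
  define col where "col K h = Pi {..<p} (\<lambda>i. if i \<in> K then {h} else UNIV)" for K and h :: 'h
  define inc where "inc J i h x =
    Pi {..<p} (\<lambda>j. if j = i then {h} else if j \<in> J then {h. x \<in> S h} else UNIV)"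
    for J i and h :: 'h and x
  \<comment> \<open>The mass of a single member is at most the load of any vertex of
    \<open>V\<close> in it.\<close>
  have pmf_le: "pmf P h \<le> \<epsilon>" if h: "h \<in> set_pmf P" for h
  proof -
    obtain v where v: "v \<in> S h" "v \<in> V" using meets[OF h] by blast
    have "measure_pmf.prob P {h} \<le> measure_pmf.prob P {h. v \<in> S h}"
      using v by (intro measure_pmf.finite_measure_mono) auto
    then show ?thesis using load[OF v(2)] by (simp add: measure_pmf_single)
  qed
  have sum_pmf: "(\<Sum>h\<in>set_pmf P. pmf P h) = 1"
    using fin by (intro sum_pmf_eq_1) auto
  have "set_pmf P \<noteq> {}" by (rule set_pmf_not_empty)
  then have eps: "0 \<le> \<epsilon>"
    using pmf_le by (meson ex_in_conv order_trans pmf_nonneg)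
  have prob_Pi: "measure_pmf.prob M (Pi {..<p} B) = (\<Prod>i<p. measure_pmf.prob P (B i))" for B
    unfolding M_def by (rule measure_Pi_pmf_Pi) simp

  \<comment> \<open>Two draws agree with probability \<Sum> \<open>(pmf P h)^2\<close>, which is at
    most \<epsilon> times the total mass 1.\<close>
  have col_le: "measure_pmf.prob M (\<Union>h\<in>set_pmf P. col K h) \<le> \<epsilon>" if "K \<in> sub 2" for K
  proof -
    have "measure_pmf.prob M (col K h) \<le> pmf P h * \<epsilon>" if h: "h \<in> set_pmf P" for h
    proof -
      have "measure_pmf.prob M (col K h) = (\<Prod>i<p. if i \<in> K then pmf P h else 1)"
        unfolding col_def prob_Pi by (intro prod.cong) (auto simp: measure_pmf_single)
      also have "\<dots> = (\<Prod>i\<in>K. pmf P h)"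
        using \<open>K \<in> sub 2\<close> unfolding sub_def by (subst prod.inter_restrict[symmetric]) (auto simp: Int_absorb1)
      also have "\<dots> = pmf P h * pmf P h"
        using \<open>K \<in> sub 2\<close> unfolding sub_def by (simp add: power2_eq_square)
      also have "\<dots> \<le> pmf P h * \<epsilon>"
        using pmf_le[OF h] by (simp add: mult_left_mono)
      finally show ?thesis .
    qed
    then have "measure_pmf.prob M (\<Union>h\<in>set_pmf P. col K h) \<le> (\<Sum>h\<in>set_pmf P. pmf P h * \<epsilon>)"
      by (intro measure_pmf_UN_le fin)
    also have "\<dots> = \<epsilon>" using sum_pmf by (simp flip: sum_distrib_right)
    finally show ?thesis .
  qed

  \<comment> \<open>The factor \<open>q\<close> counts the choices of \<open>i\<close>,
    \<open>d\<close> bounds the number of roots of \<open>h\<close>, and each of the other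
    \<open>q - 1\<close> draws hits the root with probability at most \<epsilon>. Summing over
    \<open>h\<close> costs nothing because the masses add up to 1.\<close>
  have inc_le: "measure_pmf.prob M (\<Union>i\<in>J. \<Union>h\<in>set_pmf P. \<Union>x\<in>R h. inc J i h x)
      \<le> real q * (real d * \<epsilon> ^ (q - 1))" if J: "J \<in> sub q" for J
  proof -
    have finJ: "finite J" "J \<subseteq> {..<p}" "card J = q"
      using J unfolding sub_def by (auto intro: finite_subset)
    have single: "measure_pmf.prob M (inc J i h x) \<le> pmf P h * \<epsilon> ^ (q - 1)"
      if "i \<in> J" "h \<in> set_pmf P" "x \<in> R h" for i h x
    proof -
      have "measure_pmf.prob M (inc J i h x) =
          (\<Prod>j<p. if j \<in> J then if j = i then pmf P h else measure_pmf.prob P {h. x \<in> S h} else 1)"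
        unfolding inc_def prob_Pi using \<open>i \<in> J\<close>
        by (intro prod.cong) (auto simp: measure_pmf_single)
      also have "\<dots> = (\<Prod>j\<in>J. if j = i then pmf P h else measure_pmf.prob P {h. x \<in> S h})"
        using finJ by (subst prod.inter_restrict[symmetric]) (auto simp: Int_absorb1)
      also have "\<dots> = pmf P h * measure_pmf.prob P {h. x \<in> S h} ^ (q - 1)"
        using finJ \<open>i \<in> J\<close> by (subst prod.remove[of _ i]) (auto simp: card_Diff_singleton)
      also have "\<dots> \<le> pmf P h * \<epsilon> ^ (q - 1)"
        using load[of x] R[OF that(2)] that(3) by (intro mult_left_mono power_mono) auto
      finally show ?thesis .
    qed
    have "measure_pmf.prob M (\<Union>x\<in>R h. inc J i h x) \<le> pmf P h * (real d * \<epsilon> ^ (q - 1))"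
      if "i \<in> J" "h \<in> set_pmf P" for i h
    proof -
      have "measure_pmf.prob M (\<Union>x\<in>R h. inc J i h x) \<le> (\<Sum>x\<in>R h. pmf P h * \<epsilon> ^ (q - 1))"
        using R[OF that(2)] single[OF that] by (intro measure_pmf_UN_le) auto
      also have "\<dots> = real (card (R h)) * (pmf P h * \<epsilon> ^ (q - 1))" by simp
      also have "\<dots> \<le> real d * (pmf P h * \<epsilon> ^ (q - 1))"
        using R[OF that(2)] eps by (intro mult_right_mono) auto
      finally show ?thesis by (simp add: mult_ac)
    qed
    then have "measure_pmf.prob M (\<Union>h\<in>set_pmf P. \<Union>x\<in>R h. inc J i h x)
        \<le> (\<Sum>h\<in>set_pmf P. pmf P h * (real d * \<epsilon> ^ (q - 1)))" if "i \<in> J" for i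
      using that by (intro measure_pmf_UN_le fin)
    then have "measure_pmf.prob M (\<Union>h\<in>set_pmf P. \<Union>x\<in>R h. inc J i h x) \<le> real d * \<epsilon> ^ (q - 1)"
      if "i \<in> J" for i
      using that sum_pmf by (simp flip: sum_distrib_right)
    then have "measure_pmf.prob M (\<Union>i\<in>J. \<Union>h\<in>set_pmf P. \<Union>x\<in>R h. inc J i h x)
        \<le> (\<Sum>i\<in>J. real d * \<epsilon> ^ (q - 1))"
      using finJ by (intro measure_pmf_UN_le)
    then show ?thesis using finJ by simp
  qed

  let ?A = "\<Union>K\<in>sub 2. \<Union>h\<in>set_pmf P. col K h"
  let ?B = "\<Union>J\<in>sub q. \<Union>i\<in>J. \<Union>h\<in>set_pmf P. \<Union>x\<in>R h. inc J i h x"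
  have "set_pmf M \<subseteq> ?A \<union> ?B"
  proof
    fix f assume "f \<in> set_pmf M"
    then have f: "\<And>i. i < p \<Longrightarrow> f i \<in> set_pmf P"
      unfolding M_def by (auto simp: set_Pi_pmf PiE_dflt_def)
    show "f \<in> ?A \<union> ?B"
    proof (cases "inj_on f {..<p}")
      case False
      then obtain i j where ij: "i < p" "j < p" "i \<noteq> j" "f i = f j"
        unfolding inj_on_def by auto
      then have "{i, j} \<in> sub 2" "f \<in> col {i, j} (f i)"
        unfolding sub_def col_def by auto
      then show ?thesis using f[OF ij(1)] by blast
    next
      case True
      then obtain F v where F: "F \<subseteq> f ` {..<p}" "card F = q" "\<forall>h\<in>F. v \<in> S h"
        using pq[of "f ` {..<p}"] f by (auto simp: card_image)
      then have "F \<noteq> {}" using q by auto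
      moreover have "F \<subseteq> set_pmf P" using F(1) f by auto
      ultimately obtain h x where hx: "h \<in> F" "x \<in> R h" "\<forall>h'\<in>F. x \<in> S h'"
        using roots F(3) by blast
      \<comment> \<open>Since \<open>f\<close> is injective here, the \<open>q\<close> members of
        \<open>F\<close> come from exactly \<open>q\<close> indices.\<close>
      define J where "J = {i \<in> {..<p}. f i \<in> F}"
      have "f ` J = F" using F(1) unfolding J_def by auto
      moreover have "inj_on f J" using True unfolding J_def by (rule inj_on_subset) auto
      ultimately have "J \<in> sub q"
        using F(2) card_image[of f J] unfolding sub_def J_def by auto
      moreover obtain i where i: "i \<in> J" "f i = h" using hx(1) \<open>f ` J = F\<close> by auto
      moreover have "f \<in> inc J i h x"
        using i hx(3) unfolding inc_def J_def by auto
      moreover have "h \<in> set_pmf P" using hx(1) \<open>F \<subseteq> set_pmf P\<close> by auto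
      ultimately show ?thesis using hx(2) by blast
    qed
  qed
  then have "AE f in measure_pmf M. f \<in> ?A \<union> ?B"
    by (intro AE_pmfI) blast
  then have "1 = measure_pmf.prob M (?A \<union> ?B)"
    using measure_pmf.prob_eq_1[of "?A \<union> ?B" M] by simp
  also have "\<dots> \<le> measure_pmf.prob M ?A + measure_pmf.prob M ?B"
    by (rule measure_Un_le) auto
  also have "measure_pmf.prob M ?A \<le> (\<Sum>K\<in>sub 2. \<epsilon>)"
    by (intro measure_pmf_UN_le sub col_le)
  also have "measure_pmf.prob M ?B \<le> (\<Sum>J\<in>sub q. real q * (real d * \<epsilon> ^ (q - 1)))"
    by (intro measure_pmf_UN_le sub inc_le)
  finally show ?thesis by (simp add: sub)
qed

section \<open>Numerical estimates for the bound\<close>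

text \<open>A single term of the exponential series for e^n, the one with index \<open>n\<close>, is
  at most the whole sum.\<close>

lemma fact_ge_pow_div_exp: "(real n / exp 1) ^ n \<le> fact n"
proof -
  have "(\<Sum>k\<in>{n}. real n ^ k /\<^sub>R fact k) \<le> (\<Sum>k. real n ^ k /\<^sub>R fact k)"
    by (intro sum_le_suminf summable_exp_generic) auto
  also have "\<dots> = exp (real n)" by (simp add: exp_def)
  finally have "real n ^ n /\<^sub>R fact n \<le> exp (real n)" by simp
  then have "real n ^ n \<le> exp (real n) * fact n"
    by (simp add: field_simps)
  moreover have "exp (real n) = exp 1 ^ n" by (simp flip: exp_of_nat_mult)
  ultimately show ?thesis by (simp add: power_divide field_simps)
qed

lemma binomial_le_exp_pow:
  assumes "0 < k"
  shows "real (n choose k) \<le> (exp 1 * real n / real k) ^ k"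
proof -
  have "real (n choose k) * (real k / exp 1) ^ k \<le> real (n choose k) * fact k"
    by (intro mult_left_mono fact_ge_pow_div_exp) simp
  also have "\<dots> = real ((n choose k) * fact k)" by simp
  also have "\<dots> \<le> real n ^ k"
    using binomial_fact_pow[of n k] by (metis of_nat_le_iff of_nat_power)
  finally have "real (n choose k) \<le> real n ^ k / (real k / exp 1) ^ k"
    using assms by (simp add: pos_le_divide_eq)
  also have "\<dots> = (exp 1 * real n / real k) ^ k"
    by (simp add: field_simps power_divide power_mult_distrib)
  finally show ?thesis .
qed

text \<open>The second lower bound on \<open>B\<close> makes the collision term at most 1/4. The
  remaining inequality bounds \<open>B ^ (q - 1)\<close> by an expression whose
  \<open>(q - 1)\<close>-th root is the first lower bound on \<open>B\<close> without its summand
  1.\<close>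

lemma pq_bound_contradiction:
  fixes p q d :: nat and B :: real
  assumes "p \<ge> q" "q > 1"
    and B: "2 powr (1 / (real q - 1)) * (exp 1 * real p) powr (real q / (real q - 1)) / real q
           * real d powr (1 / (real q - 1)) + 1 \<le> B" "2 * (real p)\<^sup>2 \<le> B"
    and sampling: "1 - real (p choose 2) * (1 / B)
      \<le> real (p choose q) * (real q * (real d * (1 / B) ^ (q - 1)))"
  shows False
proof -
  define X where "X = 2 powr (1 / (real q - 1)) * (exp 1 * real p) powr (real q / (real q - 1)) / real q
           * real d powr (1 / (real q - 1))"
  have q1: "real q - 1 > 0" "real (q - 1) = real q - 1" using assms(2) by auto
  have p: "0 < real p" and q: "0 < real q" using assms(1,2) by simp_all
  have "0 < 2 * (real p)\<^sup>2" using p by simp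
  then have "0 < B" using B(2) by linarith
  have "real ((p choose 2) * fact 2) \<le> real (p ^ 2)"
    using binomial_fact_pow[of p 2] by (rule of_nat_mono)
  then have "real (p choose 2) * (1 / B) \<le> 1 / 4"
    using B(2) \<open>0 < B\<close> by (simp add: field_simps fact_2)
  \<comment> \<open>The available 3/4 is weakened to 1/2, which produces the factor 2 in
    \<open>X\<close>.\<close>
  then have half: "1 / 2 \<le> real (p choose q) * (real q * (real d * (1 / B) ^ (q - 1)))"
    using sampling by linarith
  then have d: "0 < real d" by (cases "d = 0") auto
  have "B ^ (q - 1) \<le> 2 * real q * real d * real (p choose q)"
    using half \<open>0 < B\<close> by (simp add: field_simps)
  also have "\<dots> \<le> 2 * real q * real d * (exp 1 * real p / real q) ^ q"
    using binomial_le_exp_pow[of q p] assms(2) by (intro mult_left_mono) auto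
  \<comment> \<open>The factor \<open>q\<close> cancels one of the \<open>q\<close> factors in the
    denominator \<open>q ^ q\<close>; this is why \<open>X\<close> is divided by \<open>q\<close>
    itself.\<close>
  also have "\<dots> = X ^ (q - 1)"
  proof -
    have root: "(a powr (b / (real q - 1))) ^ (q - 1) = a powr b" if "0 < a" for a b :: real
      using that q1 by (simp add: powr_powr flip: powr_realpow)
    have "real q ^ q = real q * real q ^ (q - 1)"
      using assms(2) by (metis not_less_zero power_eq_if)
    moreover have "(exp 1 * real p) powr real q = (exp 1 * real p) ^ q"
      using p by (intro powr_realpow) simp
    ultimately show ?thesis
      unfolding X_def power_mult_distrib power_divide
      using root[of 2 1] root[of "exp 1 * real p" "real q"] root[of "real d" 1] p q d
      by (simp add: power_mult_distrib)
  qed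
  finally have "B ^ (q - 1) \<le> X ^ (q - 1)" .
  \<comment> \<open>The summand 1 in the bound makes this inequality strict.\<close>
  moreover have "0 \<le> X" "X < B" using B(1) q unfolding X_def by simp_all
  then have "X ^ (q - 1) < B ^ (q - 1)"
    using assms(2) by (intro power_strict_mono) auto
  ultimately show False by simp
qed

section \<open>Combining duality, roots and sampling\<close>

theorem theorem5p2:
  fixes G :: "'a pair_pre_digraph" and H :: "'a pair_pre_digraph set" and p q d :: nat
  assumes "undirected_tree G"
    and "p \<ge> q" and "q > 1"
    and "finite H"
    and "\<And>h. h \<in> H \<Longrightarrow> undirected_subgraph h G"
    and "\<And>h. h \<in> H \<Longrightarrow> at_most_components d h"
    and "pq_property G H p q"
  shows "fractional_covering_number G H \<le>
    max (2 powr (1 / (real q - 1)) * (exp 1 * real p) powr (real q / (real q - 1)) / real q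
           * real d powr (1 / (real q - 1)) + 1)
        (2 * (real p)\<^sup>2)"
    (is "_ \<le> ?B")
proof (rule ccontr)
  assume neg: "\<not> fractional_covering_number G H \<le> ?B"
  define B where "B = ?B"
  have B: "B < fractional_covering_number G H"
    using neg unfolding B_def by (simp only: not_le)
  have "0 < 2 * (real p)\<^sup>2" using assms(2,3) by simp
  also have "\<dots> \<le> B" unfolding B_def by (rule max.cobounded2)
  finally have B_pos: "0 < B" .
  have "pverts G \<noteq> {}"
    using assms(1) by (simp add: undirected_tree_def connected_def strongly_connected_def)
  have sub: "pverts h \<subseteq> pverts G" "pverts h \<noteq> {}" if "h \<in> H" for h
    using assms(5)[OF that] by (auto simp: undirected_subgraph_def subgraph_def)
  obtain w where w: "\<And>h. h \<in> H \<Longrightarrow> 0 \<le> w h" "(\<Sum>h\<in>H. w h) = 1"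
    and load: "\<And>v. v \<in> pverts G \<Longrightarrow> B * (\<Sum>h\<in>{h\<in>H. v \<in> pverts h}. w h) \<le> 1"
    using fractional_covering_number_duality[OF \<open>pverts G \<noteq> {}\<close> assms(4) sub(1) less_imp_le[OF B_pos] B]
    by blast
  obtain R where R: "\<And>h. h \<in> H \<Longrightarrow> finite (R h) \<and> card (R h) \<le> d \<and> R h \<subseteq> pverts h"
    and roots: "\<And>F v. F \<subseteq> H \<Longrightarrow> F \<noteq> {} \<Longrightarrow> \<forall>h\<in>F. v \<in> pverts h \<Longrightarrow>
      \<exists>h\<in>F. \<exists>x\<in>R h. \<forall>h'\<in>F. x \<in> pverts h'"
    using subtree_roots[OF assms(1,5,6)] by blast
  \<comment> \<open>The dual weights are extended by 0 outside \<open>H\<close>, so that they form a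
    mass function on the whole type with support inside \<open>H\<close>.\<close>
  define f where "f h = (if h \<in> H then w h else 0)" for h
  define P where "P = embed_pmf f"
  have f_nonneg: "0 \<le> f h" for h unfolding f_def using w(1) by simp
  have "(\<integral>\<^sup>+h. ennreal (f h) \<partial>count_space UNIV) = (\<Sum>h\<in>H. ennreal (f h))"
    by (rule nn_integral_count_space'[OF assms(4)]) (auto simp: f_def)
  also have "\<dots> = ennreal (\<Sum>h\<in>H. f h)"
    using f_nonneg by (intro sum_ennreal) auto
  also have "\<dots> = 1" using w(2) by (simp add: f_def)
  finally have pmf_P: "pmf P h = f h" for h
    unfolding P_def using f_nonneg by (intro pmf_embed_pmf) auto
  then have supp: "set_pmf P \<subseteq> H"
    by (auto simp: set_pmf_eq f_def split: if_splits)
  have load_P: "measure_pmf.prob P {h. v \<in> pverts h} \<le> 1 / B" if v: "v \<in> pverts G" for v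
  proof -
    have "measure_pmf.prob P {h. v \<in> pverts h} = measure_pmf.prob P {h\<in>H. v \<in> pverts h}"
      using supp by (intro measure_prob_cong_0) (auto simp: pmf_P f_def)
    also have "\<dots> = (\<Sum>h\<in>{h\<in>H. v \<in> pverts h}. w h)"
      using assms(4) by (subst measure_measure_pmf_finite) (auto simp: pmf_P f_def intro!: sum.cong)
    finally show ?thesis using load[OF v] B_pos by (simp add: pos_le_divide_eq mult.commute)
  qed
  have "1 - real (p choose 2) * (1 / B)
      \<le> real (p choose q) * (real q * (real d * (1 / B) ^ (q - 1)))"
  proof (rule pq_sampling[where V = "pverts G" and S = pverts and R = R and P = P])
    show "finite (set_pmf P)" using supp assms(4) by (rule finite_subset)
    show "pverts h \<inter> pverts G \<noteq> {}" if "h \<in> set_pmf P" for h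
      using that supp sub by blast
    show "finite (R h) \<and> card (R h) \<le> d \<and> R h \<subseteq> pverts G" if "h \<in> set_pmf P" for h
      using that supp R sub(1) by blast
    show "\<exists>h\<in>F. \<exists>x\<in>R h. \<forall>h'\<in>F. x \<in> pverts h'"
      if "F \<subseteq> set_pmf P" "F \<noteq> {}" "\<forall>h\<in>F. v \<in> pverts h" for F v
      using roots[OF order.trans[OF that(1) supp] that(2,3)] .
    show "\<exists>F'\<subseteq>F. card F' = q \<and> (\<exists>v. \<forall>h\<in>F'. v \<in> pverts h)"
      if "F \<subseteq> set_pmf P" "card F = p" for F
    proof -
      have "F \<subseteq> H" "finite F" using that supp assms(4) by (auto intro: finite_subset)
      then show ?thesis using assms(7) that(2) unfolding pq_property_def by blast
    qed
  qed (use load_P assms(3) in auto)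
  then show False
    unfolding B_def by (rule pq_bound_contradiction[OF assms(2,3) max.cobounded1 max.cobounded2])
qed

end
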